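(* Let $n\ge 1$ and $1\le p\le\infty$. Then the closure of the cone $\sum\mathbb{R}[\underline{X}]^2$ in $\mathbb{R}[\underline{X}]$ with respect to the norm $\|\cdot\|_p$ is $$\overline{\sum\mathbb{R}[\underline{X}]^2}^{\|\cdot\|_p}=\mathrm{Psd}([-1,1]^n).$$
   Context: Here $\mathbb{R}[\underline{X}]=\mathbb{R}[X_1,\ldots,X_n]$, and $\sum\mathbb{R}[\underline{X}]^2$ is the set of all finite sums of squares of polynomials. $\mathbb{N}=\{0,1,2,\ldots\}$ and $\underline{X}^\alpha=X_1^{\alpha_1}\cdots X_n^{\alpha_n}$ for $\alpha\in\mathbb{N}^n$. For $f=\sum_{\alpha\in\mathbb{N}^n} f_\alpha\underline{X}^\alpha\in\mathbb{R}[\underline{X}]$, $\|f\|_p=(\sum_\alpha|f_\alpha|^p)^{1/p}$ if $1\le p<\infty$, and $\|f\|_\infty=\sup_\alpha|f_\alpha|$. For $K\subseteq\mathbb{R}^n$, $\mathrm{Psd}(K)=\{f\in\mathbb{R}[\underline{X}] : f(x)\ge 0\text{ for all }x\in K\}$. *)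

theory Defs
  imports "HOL-Analysis.Analysis" "HOL-Library.Poly_Mapping"
begin

text \<open>
  Polynomials with real coefficients in variables indexed by the finite type \<open>'n\<close>: finitely
  supported maps from exponents \<open>\<alpha> :: 'n \<Rightarrow>\<^sub>0 nat\<close> to coefficients. The ring structure is the
  convolution product of \<open>Poly_Mapping\<close>. As \<open>'n\<close> is finite, \<open>'n \<Rightarrow>\<^sub>0 nat\<close> contains all exponents.
\<close>

type_synonym 'n rpoly = "('n \<Rightarrow>\<^sub>0 nat) \<Rightarrow>\<^sub>0 real"

definition poly_eval :: "'n::finite rpoly \<Rightarrow> real ^ 'n \<Rightarrow> real" where
  "poly_eval f x =
     (\<Sum>\<alpha>\<in>Poly_Mapping.keys f.
        Poly_Mapping.lookup f \<alpha> * (\<Prod>i\<in>UNIV. (x $ i) ^ Poly_Mapping.lookup \<alpha> i))"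

definition sums_of_squares :: "'n::finite rpoly set" where
  "sums_of_squares = {f. \<exists>hs :: 'n rpoly list. f = (\<Sum>h\<leftarrow>hs. h\<^sup>2)}"

definition Psd :: "(real ^ 'n) set \<Rightarrow> 'n::finite rpoly set" where
  "Psd K = {f. \<forall>x\<in>K. 0 \<le> poly_eval f x}"

definition coeff_norm :: "ereal \<Rightarrow> 'n::finite rpoly \<Rightarrow> real" where
  "coeff_norm p f =
     (if p = \<infinity> then (SUP \<alpha>. \<bar>Poly_Mapping.lookup f \<alpha>\<bar>)
      else (\<Sum>\<alpha>\<in>Poly_Mapping.keys f. \<bar>Poly_Mapping.lookup f \<alpha>\<bar> powr real_of_ereal p)
             powr (1 / real_of_ereal p))"

definition coeff_dist :: "ereal \<Rightarrow> 'n::finite rpoly \<Rightarrow> 'n rpoly \<Rightarrow> real" where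
  "coeff_dist p f g = coeff_norm p (f - g)"

definition coeff_topology :: "ereal \<Rightarrow> 'n::finite rpoly topology" where
  "coeff_topology p = Metric_space.mtopology UNIV (coeff_dist p)"


lemma finite_range_coeffs: "finite (range (\<lambda>\<alpha>. \<bar>Poly_Mapping.lookup (f :: 'n::finite rpoly) \<alpha>\<bar>))"
proof -
  have "range (\<lambda>\<alpha>. \<bar>Poly_Mapping.lookup f \<alpha>\<bar>) \<subseteq> insert 0 ((\<lambda>\<alpha>. \<bar>Poly_Mapping.lookup f \<alpha>\<bar>) ` Poly_Mapping.keys f)"
    by (auto simp: in_keys_iff image_iff)
  then show ?thesis
    by (rule finite_subset) simp
qed

lemma coeff_le_SUP: "\<bar>Poly_Mapping.lookup (f :: 'n::finite rpoly) \<alpha>\<bar> \<le> (SUP \<alpha>. \<bar>Poly_Mapping.lookup f \<alpha>\<bar>)"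
  by (rule cSUP_upper) (auto intro: bdd_above_finite finite_range_coeffs)

lemma coeff_norm_finite:
  assumes "finite A" "Poly_Mapping.keys f \<subseteq> A"
  shows "coeff_norm (ereal p) f = (\<Sum>\<alpha>\<in>A. \<bar>Poly_Mapping.lookup f \<alpha>\<bar> powr p) powr (1 / p)"
proof -
  have "(\<Sum>\<alpha>\<in>Poly_Mapping.keys f. \<bar>Poly_Mapping.lookup f \<alpha>\<bar> powr p) = (\<Sum>\<alpha>\<in>A. \<bar>Poly_Mapping.lookup f \<alpha>\<bar> powr p)"
    by (rule sum.mono_neutral_left) (use assms in \<open>auto simp: in_keys_iff\<close>)
  then show ?thesis
    by (simp add: coeff_norm_def)
qed

lemma coeff_norm_nonneg: "0 \<le> coeff_norm p f"
proof -
  have "0 \<le> (SUP \<alpha>. \<bar>Poly_Mapping.lookup f \<alpha>\<bar>)"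
    using coeff_le_SUP[of f 0] by linarith
  then show ?thesis
    by (simp add: coeff_norm_def)
qed

lemma coeff_norm_eq_0_iff:
  assumes "1 \<le> p"
  shows "coeff_norm p f = 0 \<longleftrightarrow> f = 0"
proof (cases p)
  case (real r)
  then show ?thesis
    using assms by (auto simp: coeff_norm_def sum_nonneg_eq_0_iff poly_mapping_eq_iff in_keys_iff
        fun_eq_iff)
next
  case PInf
  have "f = 0" if "(SUP \<alpha>. \<bar>Poly_Mapping.lookup f \<alpha>\<bar>) = 0"
    using coeff_le_SUP[of f] that by (intro poly_mapping_eqI) simp
  then show ?thesis
    using PInf by (auto simp: coeff_norm_def)
qed (use assms in auto)

lemma coeff_norm_minus: "coeff_norm p (- f) = coeff_norm p f"
  by (simp add: coeff_norm_def)

lemma powr_convex_combination: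
  fixes x y s t p :: real
  assumes "1 \<le> p" "0 \<le> x" "0 \<le> y" "0 \<le> s" "0 \<le> t" "s + t = 1"
  shows "(s * x + t * y) powr p \<le> s * x powr p + t * y powr p"
proof -
  have *: "(c * z) powr p \<le> c * z powr p" if "0 \<le> c" "c \<le> 1" "0 \<le> z" for c z :: real
  proof -
    have "c powr p \<le> c"
    proof (cases "c = 0")
      case False
      then show ?thesis
        using powr_mono'[of 1 p c] that assms(1) by simp
    qed simp
    then show ?thesis
      using that by (simp add: powr_mult mult_right_mono)
  qed
  consider "x = 0" | "y = 0" | "0 < x" "0 < y"
    using assms by linarith
  then show ?thesis
  proof cases
    case 3
    have "convex_on {0<..} (\<lambda>x::real. x powr p)"
      by (rule powr_convex) (use assms in auto)
    from convex_onD[OF this, of t x y] 3 assms show ?thesis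
      by (simp add: eq_diff_eq[symmetric])
  qed (use *[of s x] *[of t y] assms in auto)
qed

lemma coeff_norm_triangle:
  assumes p: "1 \<le> p"
  shows "coeff_norm p (f + g) \<le> coeff_norm p f + coeff_norm p g"
proof (cases p)
  case (real r)
  then have r: "1 \<le> r"
    using p by simp
  define a b where "a = coeff_norm p f" and "b = coeff_norm p g"
  show ?thesis
  proof (cases "f = 0 \<or> g = 0")
    case True
    then show ?thesis
      using coeff_norm_nonneg[of p] by auto
  next
    case False
    then have ab: "0 < a" "0 < b"
      unfolding a_def b_def
      using coeff_norm_nonneg[of p] coeff_norm_eq_0_iff[OF p] by (metis order_less_le)+
    let ?A = "Poly_Mapping.keys f \<union> Poly_Mapping.keys g"
    let ?S = "\<lambda>h. \<Sum>\<alpha>\<in>?A. \<bar>Poly_Mapping.lookup h \<alpha>\<bar> powr r"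
    have nrm: "coeff_norm p h = ?S h powr (1 / r)" if "Poly_Mapping.keys h \<subseteq> ?A" for h
      using coeff_norm_finite[of ?A h r] that real by simp
    have S: "?S h = coeff_norm p h powr r" if "Poly_Mapping.keys h \<subseteq> ?A" for h
      using r by (simp add: nrm[OF that] powr_powr sum_nonneg)
    have Sf: "?S f = a powr r" and Sg: "?S g = b powr r"
      using S by (auto simp: a_def b_def)
    have "\<bar>Poly_Mapping.lookup (f + g) \<alpha>\<bar> powr r
      \<le> (a + b) powr r * (a / (a + b) * (\<bar>Poly_Mapping.lookup f \<alpha>\<bar> powr r / a powr r)
          + b / (a + b) * (\<bar>Poly_Mapping.lookup g \<alpha>\<bar> powr r / b powr r))" for \<alpha>
    proof -
      let ?x = "\<bar>Poly_Mapping.lookup f \<alpha>\<bar> / a" and ?y = "\<bar>Poly_Mapping.lookup g \<alpha>\<bar> / b"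
      have "\<bar>Poly_Mapping.lookup (f + g) \<alpha>\<bar> \<le> \<bar>Poly_Mapping.lookup f \<alpha>\<bar> + \<bar>Poly_Mapping.lookup g \<alpha>\<bar>"
        by (simp add: lookup_add)
      also have "\<dots> = (a + b) * (a / (a + b) * ?x + b / (a + b) * ?y)"
      proof -
        have "(a + b) * (a / (a + b) * ?x) = \<bar>Poly_Mapping.lookup f \<alpha>\<bar>"
          "(a + b) * (b / (a + b) * ?y) = \<bar>Poly_Mapping.lookup g \<alpha>\<bar>"
          using ab by simp_all
        then show ?thesis
          by (simp only: distrib_left)
      qed
      finally have "\<bar>Poly_Mapping.lookup (f + g) \<alpha>\<bar> powr r
          \<le> ((a + b) * (a / (a + b) * ?x + b / (a + b) * ?y)) powr r"
        using r by (intro powr_mono2) auto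
      also have "\<dots> = (a + b) powr r * (a / (a + b) * ?x + b / (a + b) * ?y) powr r"
        using ab by (intro powr_mult)
      also have "\<dots> \<le> (a + b) powr r * (a / (a + b) * ?x powr r + b / (a + b) * ?y powr r)"
        using ab r by (intro mult_left_mono powr_convex_combination)
          (auto simp: add_divide_distrib[symmetric])
      finally show ?thesis
        using ab by (simp add: powr_divide)
    qed
    then have "?S (f + g) \<le> (\<Sum>\<alpha>\<in>?A. (a + b) powr r * (a / (a + b) * (\<bar>Poly_Mapping.lookup f \<alpha>\<bar> powr r / a powr r)
          + b / (a + b) * (\<bar>Poly_Mapping.lookup g \<alpha>\<bar> powr r / b powr r)))"
      by (rule sum_mono)
    also have "\<dots> = (a + b) powr r * (a / (a + b) * (?S f / a powr r) + b / (a + b) * (?S g / b powr r))"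
      by (simp add: sum_distrib_left[symmetric] sum.distrib sum_divide_distrib[symmetric])
    also have "\<dots> = (a + b) powr r"
      using ab by (simp add: Sf Sg add_divide_distrib[symmetric])
    finally have "?S (f + g) powr (1 / r) \<le> ((a + b) powr r) powr (1 / r)"
      using r by (intro powr_mono2) (auto intro: sum_nonneg)
    then show ?thesis
      using ab r nrm[of "f + g"] Poly_Mapping.keys_add[of f g]
      by (simp add: powr_powr a_def b_def)
  qed
next
  case PInf
  have "(SUP \<alpha>. \<bar>Poly_Mapping.lookup (f + g) \<alpha>\<bar>) \<le> (SUP \<alpha>. \<bar>Poly_Mapping.lookup f \<alpha>\<bar>) + (SUP \<alpha>. \<bar>Poly_Mapping.lookup g \<alpha>\<bar>)"
  proof (rule cSUP_least)
    fix \<alpha>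
    have "\<bar>Poly_Mapping.lookup (f + g) \<alpha>\<bar> \<le> \<bar>Poly_Mapping.lookup f \<alpha>\<bar> + \<bar>Poly_Mapping.lookup g \<alpha>\<bar>"
      by (simp add: lookup_add)
    then show "\<bar>Poly_Mapping.lookup (f + g) \<alpha>\<bar> \<le> (SUP \<alpha>. \<bar>Poly_Mapping.lookup f \<alpha>\<bar>) + (SUP \<alpha>. \<bar>Poly_Mapping.lookup g \<alpha>\<bar>)"
      using coeff_le_SUP[of f \<alpha>] coeff_le_SUP[of g \<alpha>] by linarith
  qed simp
  then show ?thesis
    using PInf by (simp add: coeff_norm_def)
qed (use p in auto)

text \<open>
  The constant \<open>Metric_space.mtopology\<close> is meaningful only for metrics, hence the following.
\<close>

lemma Metric_space_coeff_dist:
  assumes "1 \<le> p"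
  shows "Metric_space UNIV (coeff_dist p)"
proof
  show "0 \<le> coeff_dist p f g" for f g :: "'n::finite rpoly"
    by (simp add: coeff_dist_def coeff_norm_nonneg)
  show "coeff_dist p f g = coeff_dist p g f" for f g :: "'n::finite rpoly"
    using coeff_norm_minus[of p "f - g"] by (simp add: coeff_dist_def)
  show "coeff_dist p f g = 0 \<longleftrightarrow> f = g" for f g :: "'n::finite rpoly"
    using assms by (simp add: coeff_dist_def coeff_norm_eq_0_iff)
  show "coeff_dist p f h \<le> coeff_dist p f g + coeff_dist p g h" for f g h :: "'n::finite rpoly"
    using coeff_norm_triangle[OF assms, of "f - g" "g - h"] by (simp add: coeff_dist_def)
qed

end

theory Submission
  imports Defs
begin

text \<open>
  All the norms satisfy \<open>\<parallel>f\<parallel>\<^sub>\<infinity> \<le> \<parallel>f\<parallel>\<^sub>p \<le> \<parallel>f\<parallel>\<^sub>1\<close>, so the limits with respect to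
  \<open>\<parallel>\<cdot>\<parallel>\<^sub>p\<close> are also limits for \<open>p = \<infinity>\<close>, and approximations with respect to \<open>\<parallel>\<cdot>\<parallel>\<^sub>1\<close> serve for all \<open>p\<close>.

  Evaluation at a point of the open cube is continuous even for \<open>\<parallel>\<cdot>\<parallel>\<^sub>\<infinity>\<close>, because the absolute
  values of the monomials at such a point are dominated by a product of geometric series
  (\<open>poly_eval_bound\<close>). Hence a limit of sums of squares is nonnegative on the open cube, and on the
  closed cube by continuity of the limit polynomial
  (\<open>closure_of_sums_of_squares_subset_Psd\<close>).

  Conversely, \<open>\<parallel>\<cdot>\<parallel>\<^sub>1\<close> is submultiplicative, so that the \<open>\<parallel>\<cdot>\<parallel>\<^sub>1\<close>-closure of the sums of squares
  is closed under products as well as under sums and nonnegative scaling. It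
  contains \<open>1 - Z\<close> whenever \<open>\<parallel>Z\<parallel>\<^sub>1 \<le> 1\<close>, as \<open>1 - Z\<close> has a square root in the completion of the
  polynomial ring, the Banach algebra of absolutely summable coefficient families
  (\<open>one_minus_in_sos_limits\<close>). In particular it contains \<open>1 + X\<^sub>i\<close> and
  \<open>1 - X\<^sub>i\<close>, hence all products of Bernstein polynomials on \<open>[-1, 1]\<close> in the single variables.
  If \<open>f\<close> is nonnegative on the cube and \<open>\<epsilon> > 0\<close>, then by the theorem of Bernstein
  \<open>f + \<epsilon>\<close> is a combination of such products with nonnegative coefficients, provided that their degree
  is large: the coefficients of \<open>f\<close> in the Bernstein basis of degree \<open>N\<close> approach the
  values of \<open>f\<close> at the corresponding grid points, uniformly in the
  grid point (\<open>power_bernstein_expansion\<close>, \<open>Psd_cube_add_const_in_sos_limits\<close>).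
  Letting \<open>\<epsilon>\<close> tend to 0 shows that \<open>f\<close> is a limit of sums of squares.
\<close>

section \<open>Monomials and evaluation\<close>

definition const :: "real \<Rightarrow> 'n::finite rpoly" where
  "const c = Poly_Mapping.single 0 c"

definition var :: "'n::finite \<Rightarrow> 'n rpoly" where
  "var i = Poly_Mapping.single (Poly_Mapping.single i 1) 1"

lemma const_0 [simp]: "const 0 = 0"
  and const_1 [simp]: "const 1 = 1"
  and const_add: "const (a + b) = const a + const b"
  and const_diff: "const (a - b) = const a - const b"
  and const_mult: "const (a * b) = const a * const b"
  by (simp_all add: const_def single_add single_diff mult_single)

lemma const_sum: "const (sum f A) = (\<Sum>x\<in>A. const (f x))"
  by (induction A rule: infinite_finite_induct) (simp_all add: const_add)

lemma const_prod: "const (prod f A) = (\<Prod>x\<in>A. const (f x))"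
  by (induction A rule: infinite_finite_induct) (simp_all add: const_mult)

lemma const_numeral [simp]: "const (numeral n) = numeral n"
  by (simp add: const_def)

lemma poly_mapping_expand:
  fixes f :: "'a \<Rightarrow>\<^sub>0 'b::comm_monoid_add"
  shows "f = (\<Sum>\<alpha>\<in>Poly_Mapping.keys f. Poly_Mapping.single \<alpha> (Poly_Mapping.lookup f \<alpha>))"
  by (rule poly_mapping_eqI)
    (auto simp: lookup_sum lookup_single when_def in_keys_iff)

lemma single_power:
  fixes a :: "'a::comm_monoid_add"
  shows "Poly_Mapping.single a (1::real) ^ k = Poly_Mapping.single (\<Sum>_<k. a) 1"
  by (induction k) (simp_all add: mult_single add.commute)

lemma prod_single_one:
  fixes a :: "'i \<Rightarrow> 'a::comm_monoid_add"
  shows "(\<Prod>i\<in>I. Poly_Mapping.single (a i) (1::real)) = Poly_Mapping.single (\<Sum>i\<in>I. a i) 1"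
  by (induction I rule: infinite_finite_induct) (auto simp: mult_single simp flip: single_one)

lemma prod_var_power:
  fixes \<alpha> :: "'n::finite \<Rightarrow>\<^sub>0 nat"
  shows "(\<Prod>i\<in>UNIV. var i ^ Poly_Mapping.lookup \<alpha> i) = Poly_Mapping.single \<alpha> 1"
proof -
  have "(\<Sum>i\<in>UNIV. \<Sum>_<Poly_Mapping.lookup \<alpha> i. Poly_Mapping.single i (1::nat)) = \<alpha>"
    by (rule poly_mapping_eqI)
       (simp add: lookup_sum lookup_single when_def if_distrib cong: if_cong)
  then show ?thesis
    by (simp add: var_def single_power prod_single_one)
qed

lemma rpoly_expand:
  fixes f :: "'n::finite rpoly"
  shows "f = (\<Sum>\<alpha>\<in>Poly_Mapping.keys f.
     const (Poly_Mapping.lookup f \<alpha>) * (\<Prod>i\<in>UNIV. var i ^ Poly_Mapping.lookup \<alpha> i))"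
  unfolding prod_var_power const_def mult_single
  using poly_mapping_expand[of f] by simp

lemma poly_eval_superset:
  assumes "finite A" "Poly_Mapping.keys f \<subseteq> A"
  shows "poly_eval f x =
    (\<Sum>\<alpha>\<in>A. Poly_Mapping.lookup f \<alpha> * (\<Prod>i\<in>UNIV. (x $ i) ^ Poly_Mapping.lookup \<alpha> i))"
  unfolding poly_eval_def
  by (rule sum.mono_neutral_left) (use assms in \<open>auto simp: in_keys_iff\<close>)

lemma poly_eval_add: "poly_eval (f + g) x = poly_eval f x + poly_eval g x"
proof -
  let ?A = "Poly_Mapping.keys f \<union> Poly_Mapping.keys g"
  have "Poly_Mapping.keys (f + g) \<subseteq> ?A"
    by (rule Poly_Mapping.keys_add)
  then show ?thesis
    using poly_eval_superset[of ?A f x] poly_eval_superset[of ?A g x]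
      poly_eval_superset[of ?A "f + g" x]
    by (simp add: lookup_add distrib_right sum.distrib)
qed

lemma poly_eval_0 [simp]: "poly_eval 0 x = 0"
  by (simp add: poly_eval_def)

lemma poly_eval_sum: "poly_eval (sum f A) x = (\<Sum>a\<in>A. poly_eval (f a) x)"
  by (induction A rule: infinite_finite_induct) (simp_all add: poly_eval_add)

lemma poly_eval_single:
  "poly_eval (Poly_Mapping.single \<alpha> c) x = c * (\<Prod>i\<in>UNIV. (x $ i) ^ Poly_Mapping.lookup \<alpha> i)"
  by (subst poly_eval_superset[of "{\<alpha>}"]) auto

lemma mult_expand:
  fixes f g :: "'n::finite rpoly"
  shows "f * g = (\<Sum>\<alpha>\<in>Poly_Mapping.keys f. \<Sum>\<beta>\<in>Poly_Mapping.keys g.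
    Poly_Mapping.single (\<alpha> + \<beta>) (Poly_Mapping.lookup f \<alpha> * Poly_Mapping.lookup g \<beta>))"
  by (subst (1) poly_mapping_expand[of f], subst (1) poly_mapping_expand[of g])
     (simp add: sum_product mult_single)

lemma poly_eval_mult: "poly_eval (f * g) x = poly_eval f x * poly_eval g x"
  by (simp add: mult_expand poly_eval_sum poly_eval_single lookup_add power_add prod.distrib
      poly_eval_def[of f] poly_eval_def[of g] sum_product mult_ac)

lemma poly_eval_sums_of_squares_nonneg:
  assumes "f \<in> sums_of_squares"
  shows "0 \<le> poly_eval f x"
proof -
  have "0 \<le> poly_eval (\<Sum>h\<leftarrow>hs. h\<^sup>2) x" for hs
    by (induction hs) (auto simp: poly_eval_add poly_eval_mult power2_eq_square)
  then show ?thesis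
    using assms by (auto simp: sums_of_squares_def)
qed

lemma continuous_on_poly_eval: "continuous_on S (poly_eval f)"
  unfolding poly_eval_def by (intro continuous_intros)

section \<open>The coefficient norms\<close>

lemma coeff_norm_single:
  assumes "1 \<le> p"
  shows "coeff_norm p (Poly_Mapping.single \<alpha> c :: 'n::finite rpoly) = \<bar>c\<bar>"
proof (cases p)
  case (real r)
  then show ?thesis
    using assms by (subst real, subst coeff_norm_finite[of "{\<alpha>}"]) (auto simp: powr_powr)
next
  case PInf
  have "(SUP \<beta>. \<bar>Poly_Mapping.lookup (Poly_Mapping.single \<alpha> c) \<beta>\<bar>) = \<bar>c\<bar>"
    by (rule cSup_eq_maximum) (auto simp: lookup_single when_def image_iff intro!: exI[of _ \<alpha>])
  then show ?thesis
    using PInf by (simp add: coeff_norm_def)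
qed (use assms in auto)

lemma coeff_norm_0 [simp]: "1 \<le> p \<Longrightarrow> coeff_norm p 0 = 0"
  by (simp add: coeff_norm_eq_0_iff)

lemma coeff_norm_sum:
  assumes "1 \<le> p"
  shows "coeff_norm p (sum f A) \<le> (\<Sum>a\<in>A. coeff_norm p (f a))"
proof (induction A rule: infinite_finite_induct)
  case (insert a A)
  then show ?case
    using coeff_norm_triangle[OF assms, of "f a" "sum f A"] by simp
qed (use assms in simp_all)

lemma coeff_norm_1: "coeff_norm 1 f = (\<Sum>\<alpha>\<in>Poly_Mapping.keys f. \<bar>Poly_Mapping.lookup f \<alpha>\<bar>)"
  by (simp add: coeff_norm_def sum_nonneg)

text \<open>
  This is the triangle inequality for the decomposition of \<open>f\<close> into monomials: the norm of a single
  monomial does not depend on \<open>p\<close>.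
\<close>

lemma coeff_norm_le_coeff_norm_1:
  assumes "1 \<le> p"
  shows "coeff_norm p f \<le> coeff_norm 1 f"
  using coeff_norm_sum[OF assms, of "\<lambda>\<alpha>. Poly_Mapping.single \<alpha> (Poly_Mapping.lookup f \<alpha>)"
      "Poly_Mapping.keys f"]
  by (simp add: coeff_norm_single[OF assms] coeff_norm_1 flip: poly_mapping_expand)

text \<open>
  This compares \<open>\<parallel>\<cdot>\<parallel>\<^sub>p\<close> with \<open>\<parallel>\<cdot>\<parallel>\<^sub>\<infinity>\<close>.
\<close>

lemma abs_lookup_le_coeff_norm:
  assumes "1 \<le> p"
  shows "\<bar>Poly_Mapping.lookup f \<alpha>\<bar> \<le> coeff_norm p f"
proof (cases p)
  case (real r)
  then have r: "1 \<le> r"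
    using assms by simp
  let ?A = "insert \<alpha> (Poly_Mapping.keys f)"
  have "\<bar>Poly_Mapping.lookup f \<alpha>\<bar> = (\<bar>Poly_Mapping.lookup f \<alpha>\<bar> powr r) powr (1 / r)"
    using r by (simp add: powr_powr)
  also have "\<dots> \<le> (\<Sum>\<alpha>\<in>?A. \<bar>Poly_Mapping.lookup f \<alpha>\<bar> powr r) powr (1 / r)"
    using r by (intro powr_mono2 member_le_sum) auto
  also have "\<dots> = coeff_norm p f"
    unfolding real by (rule coeff_norm_finite[symmetric]) auto
  finally show ?thesis .
qed (use assms coeff_le_SUP[of f \<alpha>] in \<open>auto simp: coeff_norm_def\<close>)

lemma coeff_norm_1_mult:
  "coeff_norm 1 (f * g) \<le> coeff_norm 1 f * coeff_norm 1 g"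
proof -
  have "coeff_norm 1 (f * g) \<le> (\<Sum>\<alpha>\<in>Poly_Mapping.keys f. \<Sum>\<beta>\<in>Poly_Mapping.keys g.
     coeff_norm 1 (Poly_Mapping.single (\<alpha> + \<beta>) (Poly_Mapping.lookup f \<alpha> * Poly_Mapping.lookup g \<beta>)))"
    unfolding mult_expand
    by (intro order_trans[OF coeff_norm_sum] sum_mono) simp_all
  also have "\<dots> = coeff_norm 1 f * coeff_norm 1 g"
    by (simp add: coeff_norm_single abs_mult) (simp add: coeff_norm_1 sum_product)
  finally show ?thesis .
qed

section \<open>Evaluation on the cube\<close>

text \<open>
  Distinct exponents are distinct functions from the variables into some \<open>{..M}\<close>, and the sum of
  the monomials over all these functions factors into one geometric sum per variable.
\<close>

lemma abs_monomials_le: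
  fixes A :: "('n::finite \<Rightarrow>\<^sub>0 nat) set" and y :: "real ^ 'n"
  assumes "finite A" and r: "0 \<le> r" "r < 1" and y: "\<And>i. \<bar>y $ i\<bar> \<le> r"
  shows "(\<Sum>\<alpha>\<in>A. \<bar>\<Prod>i\<in>UNIV. (y $ i) ^ Poly_Mapping.lookup \<alpha> i\<bar>) \<le> (1 / (1 - r)) ^ CARD('n)"
proof -
  define M where "M = Max (insert 0 ((\<lambda>(\<alpha>, i). Poly_Mapping.lookup \<alpha> i) ` (A \<times> UNIV)))"
  have M: "Poly_Mapping.lookup \<alpha> i \<le> M" if "\<alpha> \<in> A" for \<alpha> i
    unfolding M_def using \<open>finite A\<close> that by (intro Max_ge) auto
  have "(\<Sum>\<alpha>\<in>A. \<bar>\<Prod>i\<in>UNIV. (y $ i) ^ Poly_Mapping.lookup \<alpha> i\<bar>)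
      \<le> (\<Sum>\<alpha>\<in>A. \<Prod>i\<in>UNIV. r ^ Poly_Mapping.lookup \<alpha> i)"
    unfolding abs_prod power_abs by (intro sum_mono prod_mono) (auto intro: power_mono y)
  also have "\<dots> = (\<Sum>k\<in>Poly_Mapping.lookup ` A. \<Prod>i\<in>UNIV. r ^ k i)"
    by (rule sum.reindex_cong[symmetric, of Poly_Mapping.lookup])
       (simp_all add: inj_on_def lookup_inject)
  also have "\<dots> \<le> (\<Sum>k\<in>PiE (UNIV :: 'n set) (\<lambda>_. {..M}). \<Prod>i\<in>UNIV. r ^ k i)"
  proof (rule sum_mono2)
    show "finite (PiE (UNIV :: 'n set) (\<lambda>_. {..M}))"
      by (rule finite_PiE) simp_all
    show "Poly_Mapping.lookup ` A \<subseteq> PiE UNIV (\<lambda>_. {..M})"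
      using M by auto
  qed (simp add: prod_nonneg r)
  also have "\<dots> = (\<Prod>i\<in>(UNIV::'n set). \<Sum>k\<le>M. r ^ k)"
    by (rule prod_sum_PiE[symmetric]) auto
  also have "\<dots> \<le> (\<Prod>i\<in>(UNIV::'n set). 1 / (1 - r))"
  proof (intro prod_mono conjI sum_nonneg)
    have "(\<Sum>k\<le>M. r ^ k) = (1 - r ^ Suc M) / (1 - r)"
      using r sum_gp_basic[of r M] by (simp add: field_simps)
    also have "\<dots> \<le> 1 / (1 - r)"
      using r by (intro divide_right_mono) auto
    finally show "(\<Sum>k\<le>M. r ^ k) \<le> 1 / (1 - r)" .
  qed (use r in auto)
  finally show ?thesis
    by simp
qed

lemma poly_eval_bound:
  fixes f :: "'n::finite rpoly"
  assumes p: "1 \<le> p" and r: "0 \<le> r" "r < 1" and y: "\<And>i. \<bar>y $ i\<bar> \<le> r"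
  shows "\<bar>poly_eval f y\<bar> \<le> coeff_norm p f * (1 / (1 - r)) ^ CARD('n)"
proof -
  have "\<bar>poly_eval f y\<bar> \<le> (\<Sum>\<alpha>\<in>Poly_Mapping.keys f. coeff_norm p f *
           \<bar>\<Prod>i\<in>UNIV. (y $ i) ^ Poly_Mapping.lookup \<alpha> i\<bar>)"
    unfolding poly_eval_def
    by (rule order_trans[OF sum_abs], rule sum_mono, unfold abs_mult)
       (intro mult_right_mono abs_lookup_le_coeff_norm p, simp)
  also have "\<dots> = coeff_norm p f * (\<Sum>\<alpha>\<in>Poly_Mapping.keys f. \<bar>\<Prod>i\<in>UNIV. (y $ i) ^ Poly_Mapping.lookup \<alpha> i\<bar>)"
    by (simp add: sum_distrib_left)
  also have "\<dots> \<le> coeff_norm p f * (1 / (1 - r)) ^ CARD('n)"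
    by (intro mult_left_mono abs_monomials_le coeff_norm_nonneg r y) simp
  finally show ?thesis .
qed

lemma closure_of_sums_of_squares:
  assumes "1 \<le> p"
  shows "coeff_topology p closure_of sums_of_squares =
    {f. \<forall>\<epsilon>>0. \<exists>g\<in>sums_of_squares. coeff_norm p (f - g) < \<epsilon>}"
proof -
  interpret Metric_space UNIV "coeff_dist p"
    by (rule Metric_space_coeff_dist[OF assms])
  show ?thesis
    by (simp add: coeff_topology_def metric_closure_of coeff_dist_def)
qed

text \<open>
  Evaluation at a boundary point of the cube is not continuous for \<open>p > 1\<close>. Therefore the point
  \<open>x\<close> is first pulled inside to \<open>r x\<close> with \<open>r < 1\<close>.
\<close>

lemma closure_of_sums_of_squares_subset_Psd:
  assumes p: "1 \<le> p"
  shows "coeff_topology p closure_of (sums_of_squares :: 'n::finite rpoly set)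
           \<subseteq> Psd {x :: real ^ 'n. \<forall>i. x $ i \<in> {-1..1}}"
proof
  fix f :: "'n rpoly"
  assume "f \<in> coeff_topology p closure_of sums_of_squares"
  then have f: "\<exists>g\<in>sums_of_squares. coeff_norm p (f - g) < \<epsilon>" if "0 < \<epsilon>" for \<epsilon>
    using that by (auto simp: closure_of_sums_of_squares[OF p])
  have interior: "0 \<le> poly_eval f y" if r: "0 \<le> r" "r < 1" and y: "\<And>i. \<bar>y $ i\<bar> \<le> r" for y r
  proof (rule field_le_epsilon)
    fix \<epsilon> :: real
    assume "0 < \<epsilon>"
    let ?K = "(1 / (1 - r)) ^ CARD('n)"
    have K: "0 < ?K"
      using r by simp
    obtain g where g: "g \<in> sums_of_squares" "coeff_norm p (f - g) < \<epsilon> / ?K"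
      using f[of "\<epsilon> / ?K"] \<open>0 < \<epsilon>\<close> K by (metis divide_pos_pos)
    have "\<bar>poly_eval (f - g) y\<bar> \<le> coeff_norm p (f - g) * ?K"
      by (rule poly_eval_bound[OF p r y])
    also have "\<dots> \<le> \<epsilon>"
      using g(2) K by (simp add: pos_less_divide_eq less_imp_le)
    finally show "0 \<le> poly_eval f y + \<epsilon>"
      using poly_eval_add[of "f - g" g y] poly_eval_sums_of_squares_nonneg[OF g(1), of y] by simp
  qed
  have "0 \<le> poly_eval f x" if x: "\<forall>i. x $ i \<in> {-1..1}" for x
  proof -
    have "((\<lambda>r. poly_eval f (r *\<^sub>R x)) \<longlongrightarrow> poly_eval f (1 *\<^sub>R x)) (at_left 1)"
      by (rule continuous_on_tendsto_compose[OF continuous_on_poly_eval[of UNIV f]])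
         (auto intro!: tendsto_eq_intros)
    moreover have "\<forall>\<^sub>F r in at_left (1::real). 0 \<le> poly_eval f (r *\<^sub>R x)"
      using eventually_at_left_real[OF zero_less_one]
    proof eventually_elim
      case (elim r)
      then show ?case
        using x by (intro interior[of r]) (auto simp: abs_mult abs_le_iff mult_le_cancel_left1)
    qed
    ultimately show ?thesis
      using tendsto_lowerbound by fastforce
  qed
  then show "f \<in> Psd {x. \<forall>i. x $ i \<in> {-1..1}}"
    by (simp add: Psd_def)
qed

section \<open>The closed cone of limits of sums of squares\<close>

definition sos_limits :: "'n::finite rpoly set" where
  "sos_limits = {f. \<forall>\<epsilon>>0. \<exists>g\<in>sums_of_squares. coeff_norm 1 (f - g) < \<epsilon>}"

lemma sum_list_squares_mult:
  fixes hs ks :: "'a::comm_ring_1 list"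
  shows "(\<Sum>h\<leftarrow>hs. h\<^sup>2) * (\<Sum>k\<leftarrow>ks. k\<^sup>2) = (\<Sum>l\<leftarrow>[h * k. h \<leftarrow> hs, k \<leftarrow> ks]. l\<^sup>2)"
  by (induction hs) (simp_all add: distrib_right power_mult_distrib sum_list_const_mult o_def)

lemma sums_of_squares_add:
  assumes "f \<in> sums_of_squares" "g \<in> sums_of_squares"
  shows "f + g \<in> sums_of_squares"
  using assms unfolding sums_of_squares_def
  by (auto simp flip: sum_list_append map_append)

lemma sums_of_squares_mult:
  assumes "f \<in> sums_of_squares" "g \<in> sums_of_squares"
  shows "f * g \<in> sums_of_squares"
  using assms unfolding sums_of_squares_def
  by (auto simp: sum_list_squares_mult)

lemma square_in_sums_of_squares: "h\<^sup>2 \<in> sums_of_squares"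
  unfolding sums_of_squares_def by (auto intro!: exI[of _ "[h]"])

lemma sos_limitsD:
  assumes "f \<in> sos_limits" "0 < \<epsilon>"
  obtains g where "g \<in> sums_of_squares" "coeff_norm 1 (f - g) < \<epsilon>"
  using assms by (auto simp: sos_limits_def)

lemma sums_of_squares_subset_sos_limits: "sums_of_squares \<subseteq> sos_limits"
  by (auto simp: sos_limits_def intro!: bexI)

lemma sos_limits_closed:
  assumes "\<And>\<epsilon>. 0 < \<epsilon> \<Longrightarrow> \<exists>g\<in>sos_limits. coeff_norm 1 (f - g) < \<epsilon>"
  shows "f \<in> sos_limits"
  unfolding sos_limits_def
proof safe
  fix \<epsilon> :: real
  assume "0 < \<epsilon>"
  then obtain g where g: "g \<in> sos_limits" "coeff_norm 1 (f - g) < \<epsilon> / 2"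
    using assms[of "\<epsilon> / 2"] by auto
  obtain h where h: "h \<in> sums_of_squares" "coeff_norm 1 (g - h) < \<epsilon> / 2"
    using sos_limitsD[OF g(1), of "\<epsilon> / 2"] \<open>0 < \<epsilon>\<close> by auto
  have "coeff_norm 1 (f - h) < \<epsilon>"
    using coeff_norm_triangle[of 1 "f - g" "g - h"] g(2) h(2) by simp
  then show "\<exists>g\<in>sums_of_squares. coeff_norm 1 (f - g) < \<epsilon>"
    using h(1) by blast
qed

lemma sos_limits_add:
  assumes "f \<in> sos_limits" "g \<in> sos_limits"
  shows "f + g \<in> sos_limits"
  unfolding sos_limits_def
proof safe
  fix \<epsilon> :: real
  assume "0 < \<epsilon>"
  then have "0 < \<epsilon> / 2"
    by simp
  obtain f' where f': "f' \<in> sums_of_squares" "coeff_norm 1 (f - f') < \<epsilon> / 2"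
    using sos_limitsD[OF assms(1) \<open>0 < \<epsilon> / 2\<close>] .
  obtain g' where g': "g' \<in> sums_of_squares" "coeff_norm 1 (g - g') < \<epsilon> / 2"
    using sos_limitsD[OF assms(2) \<open>0 < \<epsilon> / 2\<close>] .
  have "f + g - (f' + g') = (f - f') + (g - g')"
    by simp
  then have "coeff_norm 1 (f + g - (f' + g')) \<le> coeff_norm 1 (f - f') + coeff_norm 1 (g - g')"
    by (simp only: coeff_norm_triangle order_refl)
  then have "coeff_norm 1 (f + g - (f' + g')) < \<epsilon>"
    using f'(2) g'(2) by simp
  then show "\<exists>h\<in>sums_of_squares. coeff_norm 1 (f + g - h) < \<epsilon>"
    using sums_of_squares_add[OF f'(1) g'(1)] by blast
qed

text \<open>
  The factor \<open>\<parallel>g'\<parallel>\<^sub>1\<close> in the usual estimate for products is controlled by requiring the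
  precision \<open>\<delta>\<close> to be at most 1.
\<close>

lemma sos_limits_mult:
  assumes "f \<in> sos_limits" "g \<in> sos_limits"
  shows "f * g \<in> sos_limits"
  unfolding sos_limits_def
proof safe
  fix \<epsilon> :: real
  assume "0 < \<epsilon>"
  let ?F = "coeff_norm 1 f" and ?G = "coeff_norm 1 g"
  define \<delta> where "\<delta> = min 1 (\<epsilon> / (?F + ?G + 2))"
  have FG: "0 \<le> ?F" "0 \<le> ?G"
    by (rule coeff_norm_nonneg)+
  have \<delta>: "0 < \<delta>" "\<delta> \<le> 1" "\<delta> * (?F + ?G + 2) \<le> \<epsilon>"
    using FG \<open>0 < \<epsilon>\<close> by (auto simp: \<delta>_def min_mult_distrib_right)
  obtain f' where f': "f' \<in> sums_of_squares" "coeff_norm 1 (f - f') < \<delta>"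
    using sos_limitsD[OF assms(1) \<delta>(1)] .
  obtain g' where g': "g' \<in> sums_of_squares" "coeff_norm 1 (g - g') < \<delta>"
    using sos_limitsD[OF assms(2) \<delta>(1)] .
  have "coeff_norm 1 g' \<le> ?G + coeff_norm 1 (g - g')"
    using coeff_norm_triangle[of 1 g "- (g - g')"] by (simp add: coeff_norm_minus del: minus_diff_eq)
  then have G': "coeff_norm 1 g' \<le> ?G + 1"
    using g'(2) \<delta>(2) by simp
  have "f * g - f' * g' = f * (g - g') + (f - f') * g'"
    by (simp add: algebra_simps)
  then have "coeff_norm 1 (f * g - f' * g')
      \<le> coeff_norm 1 (f * (g - g')) + coeff_norm 1 ((f - f') * g')"
    by (simp only: coeff_norm_triangle order_refl)
  also have "\<dots> \<le> ?F * coeff_norm 1 (g - g') + coeff_norm 1 (f - f') * coeff_norm 1 g'"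
    by (intro add_mono coeff_norm_1_mult)
  also have "\<dots> \<le> ?F * \<delta> + \<delta> * (?G + 1)"
    using f'(2) g'(2) G' FG \<delta> coeff_norm_nonneg[of 1]
    by (intro add_mono mult_mono) auto
  also have "\<dots> < \<epsilon>"
    using \<delta> by (simp add: algebra_simps)
  finally show "\<exists>h\<in>sums_of_squares. coeff_norm 1 (f * g - h) < \<epsilon>"
    using sums_of_squares_mult[OF f'(1) g'(1)] by blast
qed

lemma const_in_sos_limits:
  assumes "0 \<le> c"
  shows "const c \<in> sos_limits"
  using square_in_sums_of_squares[of "const (sqrt c)"] sums_of_squares_subset_sos_limits assms
  by (auto simp: power2_eq_square simp flip: const_mult)

lemma sos_limits_sum:
  assumes "\<And>a. a \<in> A \<Longrightarrow> f a \<in> sos_limits"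
  shows "sum f A \<in> sos_limits"
  using assms
  by (induction A rule: infinite_finite_induct)
     (use const_in_sos_limits[of 0] in \<open>simp_all add: sos_limits_add\<close>)

lemma sos_limits_prod:
  assumes "\<And>a. a \<in> A \<Longrightarrow> f a \<in> sos_limits"
  shows "prod f A \<in> sos_limits"
  using assms
  by (induction A rule: infinite_finite_induct)
     (use const_in_sos_limits[of 1] in \<open>simp_all add: sos_limits_mult\<close>)

lemma sos_limits_power: "f \<in> sos_limits \<Longrightarrow> f ^ k \<in> sos_limits"
  using sos_limits_prod[of "{..<k}" "\<lambda>_. f"] by simp

lemma coeff_norm_const_mult: "coeff_norm 1 (const c * f) \<le> \<bar>c\<bar> * coeff_norm 1 f"
  using coeff_norm_1_mult[of "const c" f] by (simp add: const_def coeff_norm_single)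

text \<open>
  For \<open>c = 1/2\<close> this is the classical iteration for the fixed point \<open>y = 1 - \<surd>(1 - z)\<close>
  of \<open>y = (z + y\<^sup>2) / 2\<close>. It is defined in every commutative ring, so that the iteration for a polynomial can be
  compared with the one for the real number 1; \<open>c\<close> is a parameter because \<open>1/2\<close> is written
  differently in the two rings.
\<close>

fun sqrt_iter :: "'a \<Rightarrow> 'a::comm_ring_1 \<Rightarrow> nat \<Rightarrow> 'a" where
  "sqrt_iter c z 0 = 0"
| "sqrt_iter c z (Suc n) = c * (z + (sqrt_iter c z n)\<^sup>2)"

lemma sqrt_iter_diff:
  "sqrt_iter c z (Suc (Suc n)) - sqrt_iter c z (Suc n) =
     c * ((sqrt_iter c z (Suc n) - sqrt_iter c z n) * (sqrt_iter c z (Suc n) + sqrt_iter c z n))"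
proof -
  have "sqrt_iter c z (Suc (Suc n)) - sqrt_iter c z (Suc n) =
      c * (z + (sqrt_iter c z (Suc n))\<^sup>2) - c * (z + (sqrt_iter c z n)\<^sup>2)"
    by (simp only: sqrt_iter.simps(2))
  also have "c * (z + a\<^sup>2) - c * (z + b\<^sup>2) = c * ((a - b) * (a + b))" for a b
    by (simp add: algebra_simps power2_eq_square)
  finally show ?thesis .
qed

text \<open>
  The squares of \<open>1 - y\<^sub>n\<close>, for the iterates \<open>y\<^sub>n\<close> above, converge to \<open>1 - Z\<close>: the defect is
  \<open>2 (y\<^sub>n\<^sub>+\<^sub>1 - y\<^sub>n)\<close> up to sign. The factorization \<open>sqrt_iter_diff\<close> of the increments bounds their norms by the
  increments of the real iteration \<open>t\<^sub>n\<close> for \<open>z = 1\<close>, which is increasing and bounded by 1. This gives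
  convergence even in the borderline case \<open>\<parallel>Z\<parallel>\<^sub>1 = 1\<close>, which is the one needed for the variables.
\<close>

lemma one_minus_in_sos_limits:
  fixes Z :: "'n::finite rpoly"
  assumes Z: "coeff_norm 1 Z \<le> 1"
  shows "1 - Z \<in> sos_limits"
proof -
  define y where "y = sqrt_iter (const (1/2)) Z"
  define t where "t = sqrt_iter (1/2::real) 1"
  have y0: "y 0 = 0" and y_Suc: "y (Suc n) = const (1/2) * (Z + (y n)\<^sup>2)" for n
    by (simp_all add: y_def)
  have t0: "t 0 = 0" and t_Suc: "t (Suc n) = (1 + (t n)\<^sup>2) / 2" for n
    by (simp_all add: t_def)
  have t: "0 \<le> t n \<and> t n \<le> 1" for n
    by (induction n) (auto simp: t0 t_Suc abs_square_le_1 power_le_one)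
  have t_incr: "t n \<le> t (Suc n)" for n
    using zero_le_power2[of "1 - t n"] by (simp add: t_Suc power2_diff)
  have y_le: "coeff_norm 1 (y n) \<le> t n" for n
  proof (induction n)
    case (Suc n)
    have "coeff_norm 1 (y (Suc n)) \<le> 1 / 2 * coeff_norm 1 (Z + (y n)\<^sup>2)"
      unfolding y_Suc using coeff_norm_const_mult[of "1/2"] by simp
    also have "coeff_norm 1 (Z + (y n)\<^sup>2) \<le> coeff_norm 1 Z + coeff_norm 1 (y n) * coeff_norm 1 (y n)"
      unfolding power2_eq_square
      by (rule order_trans[OF coeff_norm_triangle]) (simp_all add: coeff_norm_1_mult)
    also have "\<dots> \<le> 1 + t n * t n"
      using Suc Z t[of n] coeff_norm_nonneg[of 1 "y n"] by (intro add_mono mult_mono) auto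
    finally show ?case
      by (simp add: t_Suc power2_eq_square)
  qed (simp add: y0 t0)
  have diff_le: "coeff_norm 1 (y (Suc n) - y n) \<le> t (Suc n) - t n" for n
  proof (induction n)
    case 0
    then show ?case
      using y_le[of "Suc 0"] by (simp add: y0 t0)
  next
    case (Suc n)
    have sum_le: "coeff_norm 1 (y (Suc n) + y n) \<le> t (Suc n) + t n"
      using coeff_norm_triangle[of 1 "y (Suc n)" "y n"] y_le[of n] y_le[of "Suc n"] by simp
    have "y (Suc (Suc n)) - y (Suc n) = const (1/2) * ((y (Suc n) - y n) * (y (Suc n) + y n))"
      unfolding y_def by (rule sqrt_iter_diff)
    then have "coeff_norm 1 (y (Suc (Suc n)) - y (Suc n))
        \<le> 1 / 2 * coeff_norm 1 ((y (Suc n) - y n) * (y (Suc n) + y n))"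
      using coeff_norm_const_mult[of "1/2"] by simp
    also have "\<dots> \<le> 1 / 2 * (coeff_norm 1 (y (Suc n) - y n) * coeff_norm 1 (y (Suc n) + y n))"
      using coeff_norm_1_mult by (intro mult_left_mono) auto
    also have "\<dots> \<le> 1 / 2 * ((t (Suc n) - t n) * (t (Suc n) + t n))"
      using Suc sum_le t_incr[of n] by (intro mult_left_mono mult_mono) (auto simp: coeff_norm_nonneg)
    also have "\<dots> = t (Suc (Suc n)) - t (Suc n)"
      unfolding t_def by (rule sqrt_iter_diff[symmetric])
    finally show ?case .
  qed
  have square: "1 - Z - (1 - y n)\<^sup>2 = - (const 2 * (y (Suc n) - y n))" for n
  proof -
    have "const 2 * y (Suc n) = Z + (y n)\<^sup>2"
      unfolding y_Suc by (simp only: mult.assoc[symmetric] const_mult[symmetric]) simp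
    then show ?thesis
      by (simp add: algebra_simps power2_eq_square)
  qed
  have "convergent t"
    by (rule Bseq_mono_convergent)
       (use t t_incr in \<open>auto intro!: BseqI'[of _ 1] simp: incseq_SucI[unfolded incseq_def]\<close>)
  then obtain L where "t \<longlonglongrightarrow> L"
    by (auto simp: convergent_def)
  then have "(\<lambda>n. 2 * (t (Suc n) - t n)) \<longlonglongrightarrow> 2 * (L - L)"
    by (intro tendsto_intros LIMSEQ_Suc)
  then have lim: "(\<lambda>n. 2 * (t (Suc n) - t n)) \<longlonglongrightarrow> 0"
    by simp
  show ?thesis
    unfolding sos_limits_def
  proof safe
    fix \<epsilon> :: real
    assume "0 < \<epsilon>"
    then obtain n where n: "2 * (t (Suc n) - t n) < \<epsilon>"
      using order_tendstoD(2)[OF lim, of \<epsilon>] by (auto simp: eventually_sequentially)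
    have "coeff_norm 1 (1 - Z - (1 - y n)\<^sup>2) \<le> 2 * coeff_norm 1 (y (Suc n) - y n)"
      unfolding square coeff_norm_minus using coeff_norm_const_mult[of 2 "y (Suc n) - y n"] by simp
    also have "\<dots> < \<epsilon>"
      using diff_le[of n] n by simp
    finally show "\<exists>g\<in>sums_of_squares. coeff_norm 1 (1 - Z - g) < \<epsilon>"
      using square_in_sums_of_squares by blast
  qed
qed

lemma one_plus_minus_var_in_sos_limits:
  "1 + var i \<in> sos_limits" "1 - var i \<in> sos_limits"
  using one_minus_in_sos_limits[of "- var i"] one_minus_in_sos_limits[of "var i"]
  by (simp_all add: var_def coeff_norm_minus coeff_norm_single)

section \<open>Bernstein polynomials\<close>

text \<open>
  The Bernstein basis polynomials for the interval \<open>[-1, 1]\<close>: the substitution \<open>x = (1 + Z) / 2\<close>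
  in those for \<open>[0, 1]\<close>. Their nodes are \<open>2 k / N - 1\<close> for \<open>k \<le> N\<close>.
\<close>

definition bernstein :: "nat \<Rightarrow> nat \<Rightarrow> 'n::finite rpoly \<Rightarrow> 'n rpoly" where
  "bernstein N k Z = const (real (N choose k) / 2 ^ N) * (1 + Z) ^ k * (1 - Z) ^ (N - k)"

lemma bernstein_raise_plus:
  "const (1/2) * (1 + Z) * bernstein N k Z =
     const (real (Suc k) / real (Suc N)) * bernstein (Suc N) (Suc k) Z"
proof -
  have "real (N choose k) * real (Suc N) = real (Suc N choose Suc k) * real (Suc k)"
    using Suc_times_binomial_eq[of N k] by (simp only: of_nat_mult[symmetric] mult.commute)
  then have eq: "1 / 2 * (real (N choose k) / 2 ^ N)
      = real (Suc k) / real (Suc N) * (real (Suc N choose Suc k) / 2 ^ Suc N)"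
    by (simp add: divide_simps del: of_nat_Suc binomial_Suc_Suc)
  have "const (1/2) * (1 + Z) * bernstein N k Z
      = const (1 / 2 * (real (N choose k) / 2 ^ N)) * (1 + Z) ^ Suc k * (1 - Z) ^ (N - k)"
    by (simp only: bernstein_def const_mult power_Suc mult_ac)
  also have "\<dots> = const (real (Suc k) / real (Suc N)) * bernstein (Suc N) (Suc k) Z"
    by (simp only: eq) (simp only: bernstein_def const_mult diff_Suc_Suc mult_ac)
  finally show ?thesis .
qed

lemma bernstein_raise_minus:
  assumes "k \<le> N"
  shows "const (1/2) * (1 - Z) * bernstein N k Z =
     const ((real (Suc N) - real k) / real (Suc N)) * bernstein (Suc N) k Z"
proof -
  have "Suc N * (N choose k) = (Suc N - k) * (Suc N choose k)"
    using binomial_absorb_comp[of "Suc N" k] by simp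
  from arg_cong[OF this, of real]
  have "real (N choose k) * real (Suc N) = real (Suc N choose k) * (real (Suc N) - real k)"
    using assms by (simp only: of_nat_mult of_nat_diff mult.commute le_SucI)
  then have eq: "1 / 2 * (real (N choose k) / 2 ^ N)
      = (real (Suc N) - real k) / real (Suc N) * (real (Suc N choose k) / 2 ^ Suc N)"
    by (simp add: divide_simps del: of_nat_Suc)
  have "const (1/2) * (1 - Z) * bernstein N k Z
      = const (1 / 2 * (real (N choose k) / 2 ^ N)) * (1 + Z) ^ k * (1 - Z) ^ Suc (N - k)"
    by (simp only: bernstein_def const_mult power_Suc mult_ac)
  also have "\<dots> = const ((real (Suc N) - real k) / real (Suc N)) * bernstein (Suc N) k Z"
    by (simp only: eq) (simp only: bernstein_def const_mult Suc_diff_le[OF assms] mult_ac)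
  finally show ?thesis .
qed

text \<open>
  Multiplication by \<open>Z = (1 + Z) / 2 - (1 - Z) / 2\<close> only shifts the exponents of the two factors, so
  it maps the basis of degree \<open>N\<close> to that of degree \<open>N + 1\<close>.
\<close>

lemma mult_bernstein:
  assumes "k \<le> N"
  shows "Z * bernstein N k Z =
     const (real (Suc k) / real (Suc N)) * bernstein (Suc N) (Suc k) Z
     - const ((real (Suc N) - real k) / real (Suc N)) * bernstein (Suc N) k Z"
proof -
  have "const (1/2) * (1 + Z) - const (1/2) * (1 - Z) = const (1/2 + 1/2) * Z"
    unfolding const_add by (simp add: algebra_simps)
  then have "Z = const (1/2) * (1 + Z) - const (1/2) * (1 - Z)"
    by simp
  from arg_cong[OF this, of "\<lambda>W. W * bernstein N k Z"] show ?thesis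
    by (simp only: left_diff_distrib bernstein_raise_plus bernstein_raise_minus[OF assms])
qed

lemma bernstein_partition: "(\<Sum>k\<le>N. bernstein N k Z) = 1"
proof -
  have "((1 + Z) + (1 - Z)) ^ N = (\<Sum>k\<le>N. of_nat (N choose k) * (1 + Z) ^ k * (1 - Z) ^ (N - k))"
    by (rule binomial_ring)
  moreover have "(of_nat m :: 'a rpoly) = const (real m)" for m
    by (simp add: const_def)
  ultimately have "(\<Sum>k\<le>N. bernstein N k Z) = const (1 / 2 ^ N) * ((1 + Z) + (1 - Z)) ^ N"
    by (simp add: bernstein_def sum_distrib_left divide_inverse const_mult mult_ac)
  also have "(1 + Z) + (1 - Z) = const 2"
    by simp
  also have "const 2 ^ N = const (2 ^ N)" for N
    by (induction N) (simp_all add: const_mult)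
  finally show ?thesis
    by (simp flip: const_mult)
qed

text \<open>
  The Bernstein coefficients of \<open>Z\<^sup>j\<close> approach the values of the power at the nodes, at the rate
  \<open>1 / N\<close>. By \<open>mult_bernstein\<close> the coefficients of \<open>Z\<^sup>j\<^sup>+\<^sup>1\<close> in degree \<open>N + 1\<close> are
  \<open>a\<^sub>k e\<^sub>k\<^sub>-\<^sub>1 - b\<^sub>k e\<^sub>k\<close> with the weights \<open>a\<^sub>k = k / (N + 1)\<close> and \<open>b\<^sub>k = 1 - a\<^sub>k\<close>, whose difference
  is the node \<open>a\<^sub>k - b\<^sub>k\<close>. As \<open>a\<^sub>k + b\<^sub>k = 1\<close>, neither the bound 1 nor an error bound
  deteriorates in this step, apart from the displacement of the nodes. The bound 1 allows
  errors to be added up when the expansions for several variables are multiplied.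
\<close>

lemma power_bernstein_expansion:
  "\<exists>C\<ge>0. \<forall>N>j. \<exists>e. (\<forall>Z :: 'n::finite rpoly. Z ^ j = (\<Sum>k\<le>N. const (e k) * bernstein N k Z)) \<and>
     (\<forall>k\<le>N. \<bar>e k\<bar> \<le> 1 \<and> \<bar>e k - (2 * real k / real N - 1) ^ j\<bar> \<le> C / real N)"
proof (induction j)
  case 0
  then show ?case
    by (intro exI[of _ 0] conjI allI impI exI[of _ "\<lambda>_. 1"]) (simp_all add: bernstein_partition)
next
  case (Suc j)
  then obtain C where C: "0 \<le> C" and
    ex: "\<And>N. j < N \<Longrightarrow> \<exists>e. (\<forall>Z :: 'n rpoly. Z ^ j = (\<Sum>k\<le>N. const (e k) * bernstein N k Z)) \<and>
     (\<forall>k\<le>N. \<bar>e k\<bar> \<le> 1 \<and> \<bar>e k - (2 * real k / real N - 1) ^ j\<bar> \<le> C / real N)"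
    by blast
  \<comment> \<open>The displacement of the nodes contributes \<open>2 j / N\<close>; the factor 2 accounts for passing from
    \<open>1 / N\<close> to \<open>1 / (N + 1)\<close>.\<close>
  define C' where "C' = 2 * (C + 2 * real j)"
  have "\<exists>e. (\<forall>Z :: 'n rpoly. Z ^ Suc j = (\<Sum>k\<le>N'. const (e k) * bernstein N' k Z)) \<and>
     (\<forall>k\<le>N'. \<bar>e k\<bar> \<le> 1 \<and> \<bar>e k - (2 * real k / real N' - 1) ^ Suc j\<bar> \<le> C' / real N')"
    if less: "Suc j < N'" for N'
  proof -
    obtain N where N': "N' = Suc N" and N: "j < N"
      using less by (cases N') auto
    from ex[OF N] obtain e where
      e: "\<And>Z :: 'n rpoly. Z ^ j = (\<Sum>k\<le>N. const (e k) * bernstein N k Z)" and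
      e_le: "\<And>k. k \<le> N \<Longrightarrow> \<bar>e k\<bar> \<le> 1" and
      e_near: "\<And>k. k \<le> N \<Longrightarrow> \<bar>e k - (2 * real k / real N - 1) ^ j\<bar> \<le> C / real N"
      by blast
    \<comment> \<open>The weights of the step of the induction; the predecessor \<open>k - 1\<close> below is
      harmless at \<open>k = 0\<close>, where its weight is zero.\<close>
    define a where "a k = real k / real (Suc N)" for k
    define b where "b k = (real (Suc N) - real k) / real (Suc N)" for k
    define e' where "e' k = a k * e (k - 1) - b k * e k" for k
    have ab: "a k + b k = 1" for k
      by (simp add: a_def b_def field_simps del: of_nat_Suc)
    have a0: "0 \<le> a k" for k
      by (simp add: a_def)
    have b0: "0 \<le> b k" if "k \<le> Suc N" for k
      using that by (simp add: b_def del: of_nat_Suc)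
    \<comment> \<open>At \<open>k = N + 1\<close> the index \<open>k\<close> is out of range for degree \<open>N\<close>, but its weight is zero.\<close>
    have estimate: "\<bar>a k * x (k - 1) - b k * x k\<bar> \<le> D"
      if k: "k \<le> Suc N" and x: "\<And>l. l \<le> N \<Longrightarrow> l \<le> k \<Longrightarrow> k \<le> Suc l \<Longrightarrow> \<bar>x l\<bar> \<le> D" for x k D
    proof -
      have "\<bar>a k * x (k - 1)\<bar> \<le> a k * D"
        using x[of "k - 1"] k a0[of k] by (auto simp: abs_mult intro!: mult_left_mono)
      moreover have "\<bar>b k * x k\<bar> \<le> b k * D"
      proof (cases "k = Suc N")
        case True
        then show ?thesis
          by (simp add: b_def)
      next
        case False
        then show ?thesis
          using x[of k] k b0[of k] by (auto simp: abs_mult intro!: mult_left_mono)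
      qed
      moreover have "a k * D + b k * D = D"
        by (simp add: ab flip: distrib_right)
      ultimately show ?thesis
        by linarith
    qed
    have raise: "Z * bernstein N k Z = const (a (Suc k)) * bernstein (Suc N) (Suc k) Z
        - const (b k) * bernstein (Suc N) k Z" if "k \<le> N" for k and Z :: "'n rpoly"
      unfolding a_def b_def by (rule mult_bernstein[OF that])
    have "Z ^ Suc j = (\<Sum>k\<le>Suc N. const (e' k) * bernstein (Suc N) k Z)" for Z :: "'n rpoly"
    proof -
      have "Z ^ Suc j = (\<Sum>k\<le>N. const (e k) * (Z * bernstein N k Z))"
        by (simp add: e sum_distrib_left mult_ac)
      also have "\<dots> = (\<Sum>k\<le>N. const (a (Suc k) * e k) * bernstein (Suc N) (Suc k) Z)
          - (\<Sum>k\<le>N. const (b k * e k) * bernstein (Suc N) k Z)"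
        by (simp add: raise const_mult right_diff_distrib sum_subtractf mult_ac)
      also have "(\<Sum>k\<le>N. const (a (Suc k) * e k) * bernstein (Suc N) (Suc k) Z)
          = (\<Sum>k\<le>Suc N. const (a k * e (k - 1)) * bernstein (Suc N) k Z)"
        by (subst sum.atMost_Suc_shift) (simp add: a_def)
      also have "(\<Sum>k\<le>N. const (b k * e k) * bernstein (Suc N) k Z)
          = (\<Sum>k\<le>Suc N. const (b k * e k) * bernstein (Suc N) k Z)"
        by (simp add: b_def)
      finally show ?thesis
        by (simp only: e'_def const_diff left_diff_distrib sum_subtractf)
    qed
    moreover have "\<bar>e' k\<bar> \<le> 1" if "k \<le> Suc N" for k
      unfolding e'_def by (rule estimate[OF that e_le])
    moreover have "\<bar>e' k - (2 * real k / real (Suc N) - 1) ^ Suc j\<bar> \<le> C' / real (Suc N)"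
      if k: "k \<le> Suc N" for k
    proof -
      define y where "y = 2 * real k / real (Suc N) - 1"
      have "y = 2 * a k - 1"
        by (simp add: y_def a_def)
      then have y: "y = a k - b k" "\<bar>y\<bar> \<le> 1"
        using a0[of k] b0[OF k] ab[of k] by auto
      have N0: "0 < real N"
        using N by simp
      \<comment> \<open>The nodes of degree \<open>N\<close> with index \<open>k - 1\<close> and \<open>k\<close> are close to the node of
        degree \<open>N + 1\<close> with index \<open>k\<close>.\<close>
      have near: "\<bar>e l - y ^ j\<bar> \<le> (C + 2 * real j) / real N"
        if l: "l \<le> N" "l \<le> k" "k \<le> Suc l" for l
      proof -
        have "\<bar>2 * real l / real N - 1\<bar> \<le> 1"
          using l(1) N0 by (simp add: abs_le_iff field_simps)
        then have "\<bar>(2 * real l / real N - 1) ^ j - y ^ j\<bar> \<le> real j * \<bar>(2 * real l / real N - 1) - y\<bar>"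
          using norm_power_diff[of "2 * real l / real N - 1" y j] y(2) by simp
        also have "\<bar>(2 * real l / real N - 1) - y\<bar> \<le> 2 / real N"
        proof -
          have "real l / real N - real k / real (Suc N) =
              (real l - real N * (real k - real l)) / (real N * real (Suc N))"
            using N0 by (simp add: field_simps)
          moreover have "\<bar>real l - real N * (real k - real l)\<bar> \<le> real (Suc N)"
            using l by (cases "k = l") (auto simp: le_Suc_eq)
          ultimately have "\<bar>real l / real N - real k / real (Suc N)\<bar> \<le> real (Suc N) / (real N * real (Suc N))"
            by (simp only: abs_divide abs_mult abs_of_nat) (erule divide_right_mono, simp)
          then show ?thesis
            using N0 by (simp add: y_def)
        qed
        finally have "\<bar>(2 * real l / real N - 1) ^ j - y ^ j\<bar> \<le> real j * (2 / real N)"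
          by (simp add: mult_left_mono)
        then show ?thesis
          using e_near[OF l(1)] by (simp add: add_divide_distrib mult.commute)
      qed
      have "e' k - y ^ Suc j = a k * (e (k - 1) - y ^ j) - b k * (e k - y ^ j)"
        by (simp add: e'_def y(1) algebra_simps)
      also have "\<bar>\<dots>\<bar> \<le> (C + 2 * real j) / real N"
        by (rule estimate[OF k, of "\<lambda>l. e l - y ^ j"]) (rule near)
      also have "\<dots> \<le> C' / real (Suc N)"
      proof -
        have "1 / real N \<le> 2 / real (Suc N)"
          using N by (simp add: field_simps)
        then have "(C + 2 * real j) * (1 / real N) \<le> (C + 2 * real j) * (2 / real (Suc N))"
          using C by (intro mult_left_mono) simp_all
        then show ?thesis
          by (simp add: C'_def mult.commute del: of_nat_Suc)
      qed
      finally show ?thesis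
        by (simp add: y_def)
    qed
    ultimately show ?thesis
      unfolding N' by blast
  qed
  moreover have "0 \<le> C'"
    using C by (simp add: C'_def)
  ultimately show ?case
    by blast
qed

section \<open>Polynomials that are nonnegative on the cube\<close>

text \<open>
  The expansions of the powers of the single variables multiply to an expansion of \<open>f\<close> in the products
  of Bernstein polynomials, which form a partition of unity. Its coefficients differ by at most
  \<open>K / N\<close> from values of \<open>f\<close> on the cube, so adding \<open>\<epsilon>\<close> to all of them makes them nonnegative.
\<close>

lemma Psd_cube_add_const_in_sos_limits:
  fixes f :: "'n::finite rpoly"
  assumes f: "f \<in> Psd {x :: real ^ 'n. \<forall>i. x $ i \<in> {-1..1}}" and "0 < \<epsilon>"
  shows "f + const \<epsilon> \<in> sos_limits"
proof -
  define P where "P j N C e \<longleftrightarrow> (\<forall>Z :: 'n rpoly. Z ^ j = (\<Sum>k\<le>N. const (e k) * bernstein N k Z)) \<and>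
     (\<forall>k\<le>N. \<bar>e k\<bar> \<le> 1 \<and> \<bar>e k - (2 * real k / real N - 1) ^ j\<bar> \<le> C / real N)"
    for j N :: nat and C :: real and e
  have "\<exists>C\<ge>0. \<forall>N>j. \<exists>e. P j N C e" for j
    unfolding P_def by (rule power_bernstein_expansion)
  then obtain C where C: "\<And>j N. j < N \<Longrightarrow> \<exists>e. P j N (C j) e"
    by metis
  let ?A = "Poly_Mapping.keys f"
  define K where "K = (\<Sum>\<alpha>\<in>?A. \<bar>Poly_Mapping.lookup f \<alpha>\<bar> * (\<Sum>i\<in>UNIV. C (Poly_Mapping.lookup \<alpha> i)))"
  define d where "d = Max (insert 0 ((\<lambda>(\<alpha>, i). Poly_Mapping.lookup \<alpha> i) ` (?A \<times> UNIV)))"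
  have d: "Poly_Mapping.lookup \<alpha> i \<le> d" if "\<alpha> \<in> ?A" for \<alpha> i
    unfolding d_def using that by (intro Max_ge) auto
  \<comment> \<open>Large enough for \<open>K / N \<le> \<epsilon>\<close>, and larger than every exponent that occurs in \<open>f\<close>.\<close>
  define N where "N = Suc (max d (nat \<lceil>K / \<epsilon>\<rceil>))"
  have N: "d < N" "0 < real N"
    by (auto simp: N_def)
  have "K / \<epsilon> \<le> real N"
    unfolding N_def by linarith
  then have KN: "K / real N \<le> \<epsilon>"
    using N(2) \<open>0 < \<epsilon>\<close> by (simp add: field_simps)
  have "\<forall>j. \<exists>e. j < N \<longrightarrow> P j N (C j) e"
    using C by blast
  from choice[OF this] obtain e where P: "\<And>j. j < N \<Longrightarrow> P j N (C j) (e j)"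
    by blast
  then have
    e: "\<And>j Z. j < N \<Longrightarrow> (Z :: 'n rpoly) ^ j = (\<Sum>k\<le>N. const (e j k) * bernstein N k Z)" and
    e_le: "\<And>j k. j < N \<Longrightarrow> k \<le> N \<Longrightarrow> \<bar>e j k\<bar> \<le> 1" and
    e_near: "\<And>j k. j < N \<Longrightarrow> k \<le> N \<Longrightarrow> \<bar>e j k - (2 * real k / real N - 1) ^ j\<bar> \<le> C j / real N"
    unfolding P_def by auto
  define S where "S = PiE (UNIV :: 'n set) (\<lambda>_. {..N})"
  define B :: "('n \<Rightarrow> nat) \<Rightarrow> 'n rpoly" where "B \<kappa> = (\<Prod>i\<in>UNIV. bernstein N (\<kappa> i) (var i))" for \<kappa>
  define c where "c \<kappa> = (\<Sum>\<alpha>\<in>?A. Poly_Mapping.lookup f \<alpha> * (\<Prod>i\<in>UNIV. e (Poly_Mapping.lookup \<alpha> i) (\<kappa> i)))" for \<kappa>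
  have f_eq: "f = (\<Sum>\<kappa>\<in>S. const (c \<kappa>) * B \<kappa>)"
  proof -
    have "f = (\<Sum>\<alpha>\<in>?A. const (Poly_Mapping.lookup f \<alpha>) *
        (\<Prod>i\<in>UNIV. \<Sum>k\<le>N. const (e (Poly_Mapping.lookup \<alpha> i) k) * bernstein N k (var i)))"
      by (subst rpoly_expand) (auto intro!: sum.cong prod.cong arg_cong2[of _ _ _ _ "(*)"] e le_less_trans[OF d N(1)])
    also have "\<dots> = (\<Sum>\<alpha>\<in>?A. \<Sum>\<kappa>\<in>S. const (Poly_Mapping.lookup f \<alpha> * (\<Prod>i\<in>UNIV. e (Poly_Mapping.lookup \<alpha> i) (\<kappa> i))) * B \<kappa>)"
      by (simp add: prod_sum_PiE S_def B_def prod.distrib const_mult const_prod sum_distrib_left mult_ac)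
    also have "\<dots> = (\<Sum>\<kappa>\<in>S. const (c \<kappa>) * B \<kappa>)"
      by (subst sum.swap) (simp add: c_def const_sum sum_distrib_right)
    finally show ?thesis .
  qed
  have one_eq: "1 = (\<Sum>\<kappa>\<in>S. B \<kappa>)"
    unfolding S_def B_def by (subst prod_sum_PiE[symmetric]) (simp_all add: bernstein_partition)
  have c: "0 \<le> c \<kappa> + \<epsilon>" if \<kappa>: "\<kappa> \<in> S" for \<kappa>
  proof -
    define x :: "real ^ 'n" where "x = (\<chi> i. 2 * real (\<kappa> i) / real N - 1)"
    have \<kappa>_le: "\<kappa> i \<le> N" for i
      using \<kappa> by (auto simp: S_def)
    have x: "x $ i \<in> {-1..1}" for i
      using \<kappa>_le[of i] N(2) by (simp add: x_def field_simps)
    have "\<bar>c \<kappa> - poly_eval f x\<bar> \<le> (\<Sum>\<alpha>\<in>?A. \<bar>Poly_Mapping.lookup f \<alpha>\<bar> *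
        ((\<Sum>i\<in>UNIV. C (Poly_Mapping.lookup \<alpha> i)) / real N))"
      unfolding c_def poly_eval_def sum_subtractf[symmetric] right_diff_distrib[symmetric]
    proof (rule order_trans[OF sum_abs], rule sum_mono, unfold abs_mult, rule mult_left_mono)
      fix \<alpha> assume \<alpha>: "\<alpha> \<in> ?A"
      note less = le_less_trans[OF d[OF \<alpha>] N(1)]
      have "\<bar>(\<Prod>i\<in>UNIV. e (Poly_Mapping.lookup \<alpha> i) (\<kappa> i)) - (\<Prod>i\<in>UNIV. x $ i ^ Poly_Mapping.lookup \<alpha> i)\<bar>
          \<le> (\<Sum>i\<in>UNIV. \<bar>e (Poly_Mapping.lookup \<alpha> i) (\<kappa> i) - x $ i ^ Poly_Mapping.lookup \<alpha> i\<bar>)"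
        using norm_prod_diff[of UNIV "\<lambda>i. e (Poly_Mapping.lookup \<alpha> i) (\<kappa> i)" "\<lambda>i. x $ i ^ Poly_Mapping.lookup \<alpha> i"]
          e_le[OF less \<kappa>_le] x by (simp add: power_abs power_le_one abs_le_iff)
      also have "\<dots> \<le> (\<Sum>i\<in>UNIV. C (Poly_Mapping.lookup \<alpha> i) / real N)"
        using e_near[OF less \<kappa>_le] by (intro sum_mono) (simp add: x_def)
      finally show "\<bar>(\<Prod>i\<in>UNIV. e (Poly_Mapping.lookup \<alpha> i) (\<kappa> i)) - (\<Prod>i\<in>UNIV. x $ i ^ Poly_Mapping.lookup \<alpha> i)\<bar>
          \<le> (\<Sum>i\<in>UNIV. C (Poly_Mapping.lookup \<alpha> i)) / real N"
        by (simp add: sum_divide_distrib)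
    qed simp
    also have "\<dots> = K / real N"
      by (simp add: K_def sum_divide_distrib[of _ ?A])
    finally have "\<bar>c \<kappa> - poly_eval f x\<bar> \<le> \<epsilon>"
      using KN by simp
    moreover have "0 \<le> poly_eval f x"
      using f x by (simp add: Psd_def)
    ultimately show ?thesis
      by linarith
  qed
  have "f + const \<epsilon> = (\<Sum>\<kappa>\<in>S. const (c \<kappa>) * B \<kappa>) + const \<epsilon> * (\<Sum>\<kappa>\<in>S. B \<kappa>)"
    by (simp flip: f_eq one_eq)
  also have "\<dots> = (\<Sum>\<kappa>\<in>S. const (c \<kappa> + \<epsilon>) * B \<kappa>)"
    by (simp add: sum_distrib_left const_add distrib_right sum.distrib)
  also have "\<dots> \<in> sos_limits"
    unfolding B_def bernstein_def
    by (intro sos_limits_sum sos_limits_mult sos_limits_prod sos_limits_power const_in_sos_limits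
        one_plus_minus_var_in_sos_limits c) simp_all
  finally show ?thesis .
qed

theorem theorem3p8:
  fixes p :: ereal
  assumes "1 \<le> p"
  shows "coeff_topology p closure_of (sums_of_squares :: 'n::finite rpoly set)
           = Psd {x :: real ^ 'n. \<forall>i. x $ i \<in> {-1..1}}"
proof
  show "Psd {x :: real ^ 'n. \<forall>i. x $ i \<in> {-1..1}} \<subseteq> coeff_topology p closure_of sums_of_squares"
  proof
    fix f :: "'n rpoly"
    assume f: "f \<in> Psd {x. \<forall>i. x $ i \<in> {-1..1}}"
    have "\<exists>g\<in>sos_limits. coeff_norm 1 (f - g) < \<epsilon>" if "0 < \<epsilon>" for \<epsilon>
      using Psd_cube_add_const_in_sos_limits[OF f, of "\<epsilon> / 2"] that
      by (intro bexI[of _ "f + const (\<epsilon> / 2)"])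
         (simp_all add: coeff_norm_minus const_def coeff_norm_single)
    then have "f \<in> sos_limits"
      by (rule sos_limits_closed)
    then show "f \<in> coeff_topology p closure_of sums_of_squares"
      using coeff_norm_le_coeff_norm_1[OF assms] le_less_trans
      unfolding closure_of_sums_of_squares[OF assms] sos_limits_def by blast
  qed
qed (rule closure_of_sums_of_squares_subset_Psd[OF assms])

end
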